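(* Let $\mathcal{H}$ be a complex Hilbert space and let $T\in\mathcal{B}(\mathcal{H})$ be such that $T^*T\ge I$ and such that $T$ has, with respect to an orthogonal decomposition $\mathcal{H}=\mathcal{G}\oplus\mathcal{G}^{\perp}$, the block matrix form $$T=\begin{pmatrix} S & R\\ 0 & Q\end{pmatrix},$$ where $S$ is an isometry on $\mathcal{G}$, $R\in\mathcal{B}(\mathcal{G}^{\perp},\mathcal{G})$ satisfies $S^*R=0$, and $Q$ is a contraction on $\mathcal{G}^{\perp}$. If $T$ satisfies $|T|\le|\mathrm{Re}\,T|$, then $T$ is self-adjoint, in fact a symmetry.
   Context: $\mathcal{B}(\mathcal{H},\mathcal{K})$ is the space of bounded linear operators from $\mathcal{H}$ to $\mathcal{K}$, and $\mathcal{B}(\mathcal{H})=\mathcal{B}(\mathcal{H},\mathcal{H})$. For $T\in\mathcal{B}(\mathcal{H})$, $|T|=(T^*T)^{1/2}$ and $\mathrm{Re}\,T=\frac12(T+T^* )$; inequalities between self-adjoint operators are in the usual order. A contraction is an operator of norm at most $1$. A symmetry is a unitary operator $U$ with $U^*=U$. $\mathcal{G}$ is a closed subspace of $\mathcal{H}$. *)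

theory Defs
  imports "HOL-Analysis.Analysis"
begin

text \<open>Complex Hilbert spaces as a type class. The norm, the metric and the topology are those of
  the underlying real normed space, and the inner product is linear in its first argument.\<close>

class complex_inner = real_normed_vector +
  fixes scaleC :: "complex \<Rightarrow> 'a \<Rightarrow> 'a"
    and cinner :: "'a \<Rightarrow> 'a \<Rightarrow> complex"
  assumes scaleC_add_right: "scaleC c (x + y) = scaleC c x + scaleC c y"
    and scaleC_add_left: "scaleC (c + d) x = scaleC c x + scaleC d x"
    and scaleC_scaleC: "scaleC c (scaleC d x) = scaleC (c * d) x"
    and scaleC_of_real: "scaleC (complex_of_real r) x = r *\<^sub>R x"
    and cinner_commute: "cinner x y = cnj (cinner y x)"
    and cinner_add_left: "cinner (x + y) z = cinner x z + cinner y z"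
    and cinner_scaleC_left: "cinner (scaleC c x) y = c * cinner x y"
    and cinner_norm: "cinner x x = complex_of_real ((norm x)\<^sup>2)"

class chilbert_space = complex_inner + complete_space

instantiation complex :: chilbert_space
begin

definition scaleC_complex :: "complex \<Rightarrow> complex \<Rightarrow> complex" where
  "scaleC_complex c x = c * x"

definition cinner_complex :: "complex \<Rightarrow> complex \<Rightarrow> complex" where
  "cinner_complex x y = x * cnj y"

instance
  by standard
    (simp_all add: scaleC_complex_def cinner_complex_def algebra_simps scaleR_conv_of_real
      flip: complex_norm_square)

end

definition closed_csubspace :: "'a::complex_inner set \<Rightarrow> bool" where
  "closed_csubspace M \<longleftrightarrow>
     0 \<in> M \<and> (\<forall>x\<in>M. \<forall>y\<in>M. x + y \<in> M) \<and> (\<forall>c. \<forall>x\<in>M. scaleC c x \<in> M) \<and> closed M"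

definition ortho_compl :: "'a::complex_inner set \<Rightarrow> 'a set" where
  "ortho_compl M = {y. \<forall>x\<in>M. cinner x y = 0}"

text \<open>An operator between closed subspaces \<open>M\<close> and \<open>N\<close> is represented by a function on the
  ambient type, of which only the values on \<open>M\<close> matter. Operators on the whole space are
  those with \<open>M = N = UNIV\<close>.\<close>

definition bounded_op :: "'a::complex_inner set \<Rightarrow> 'a set \<Rightarrow> ('a \<Rightarrow> 'a) \<Rightarrow> bool" where
  "bounded_op M N A \<longleftrightarrow>
     (\<forall>x\<in>M. A x \<in> N) \<and>
     (\<forall>x\<in>M. \<forall>y\<in>M. A (x + y) = A x + A y) \<and>
     (\<forall>c. \<forall>x\<in>M. A (scaleC c x) = scaleC c (A x)) \<and>
     (\<exists>K. \<forall>x\<in>M. norm (A x) \<le> K * norm x)"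

text \<open>Relative version of \<^const>\<open>onorm\<close>, which is the case \<open>M = UNIV\<close>.\<close>

definition onorm_on :: "'a::complex_inner set \<Rightarrow> ('a \<Rightarrow> 'a) \<Rightarrow> real" where
  "onorm_on M A = (SUP x\<in>M. norm (A x) / norm x)"

definition contraction_on :: "'a::complex_inner set \<Rightarrow> ('a \<Rightarrow> 'a) \<Rightarrow> bool" where
  "contraction_on M A \<longleftrightarrow> bounded_op M M A \<and> onorm_on M A \<le> 1"

definition isometry_on :: "'a::complex_inner set \<Rightarrow> ('a \<Rightarrow> 'a) \<Rightarrow> bool" where
  "isometry_on M A \<longleftrightarrow> bounded_op M M A \<and> (\<forall>x\<in>M. norm (A x) = norm x)"

text \<open>For \<open>A\<close> bounded from \<open>M\<close> to \<open>N\<close>, the adjoint is a map from \<open>N\<close> to \<open>M\<close>; by the Riesz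
  representation theorem in \<open>M\<close> the described element exists and is unique.\<close>

definition adj_on :: "'a::complex_inner set \<Rightarrow> ('a \<Rightarrow> 'a) \<Rightarrow> 'a \<Rightarrow> 'a" where
  "adj_on M A y = (THE z. z \<in> M \<and> (\<forall>x\<in>M. cinner (A x) y = cinner x z))"

abbreviation adj :: "('a::complex_inner \<Rightarrow> 'a) \<Rightarrow> 'a \<Rightarrow> 'a" where
  "adj \<equiv> adj_on UNIV"

text \<open>On a complex space nonnegativity of the quadratic form already makes the operator
  self-adjoint.\<close>

definition positive_op :: "('a::complex_inner \<Rightarrow> 'a) \<Rightarrow> bool" where
  "positive_op A \<longleftrightarrow> bounded_op UNIV UNIV A \<and> (\<forall>x. cinner (A x) x \<in> \<real>\<^sub>\<ge>\<^sub>0)"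

definition op_le :: "('a::complex_inner \<Rightarrow> 'a) \<Rightarrow> ('a \<Rightarrow> 'a) \<Rightarrow> bool" where
  "op_le A B \<longleftrightarrow> positive_op (\<lambda>x. B x - A x)"

definition sqrt_op :: "('a::complex_inner \<Rightarrow> 'a) \<Rightarrow> 'a \<Rightarrow> 'a" where
  "sqrt_op A = (THE P. positive_op P \<and> P \<circ> P = A)"

definition abs_op :: "('a::complex_inner \<Rightarrow> 'a) \<Rightarrow> 'a \<Rightarrow> 'a" where
  "abs_op T = sqrt_op (adj T \<circ> T)"

definition Re_op :: "('a::complex_inner \<Rightarrow> 'a) \<Rightarrow> 'a \<Rightarrow> 'a" where
  "Re_op T = (\<lambda>x. (1/2) *\<^sub>R (T x + adj T x))"

definition selfadjoint_op :: "('a::complex_inner \<Rightarrow> 'a) \<Rightarrow> bool" where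
  "selfadjoint_op T \<longleftrightarrow> bounded_op UNIV UNIV T \<and> adj T = T"

definition unitary_op :: "('a::complex_inner \<Rightarrow> 'a) \<Rightarrow> bool" where
  "unitary_op U \<longleftrightarrow> bounded_op UNIV UNIV U \<and> adj U \<circ> U = id \<and> U \<circ> adj U = id"

definition symmetry_op :: "('a::complex_inner \<Rightarrow> 'a) \<Rightarrow> bool" where
  "symmetry_op U \<longleftrightarrow> unitary_op U \<and> adj U = U"

text \<open>\<open>T\<close> has the block matrix with rows \<open>(A, B)\<close> and \<open>(C, D)\<close> with respect to the orthogonal
  decomposition of the whole space into \<open>G\<close> and \<open>ortho_compl G\<close>.\<close>

definition block_matrix_form ::
  "'a::complex_inner set \<Rightarrow> ('a \<Rightarrow> 'a) \<Rightarrow>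
     ('a \<Rightarrow> 'a) \<Rightarrow> ('a \<Rightarrow> 'a) \<Rightarrow> ('a \<Rightarrow> 'a) \<Rightarrow> ('a \<Rightarrow> 'a) \<Rightarrow> bool" where
  "block_matrix_form G T A B C D \<longleftrightarrow>
     bounded_op G G A \<and> bounded_op (ortho_compl G) G B \<and>
     bounded_op G (ortho_compl G) C \<and> bounded_op (ortho_compl G) (ortho_compl G) D \<and>
     (\<forall>x\<in>G. \<forall>y\<in>ortho_compl G. T (x + y) = (A x + B y) + (C x + D y))"

end

theory Submission
  imports Defs
begin

text \<open>If \<open>T\<^sup>*T x = x\<close> then \<open>|T| x = x\<close>, so \<open>|T| \<le> |Re T|\<close> gives
  \<open>\<parallel>x\<parallel> \<le> \<parallel>Re T x\<parallel> = \<parallel>T x + T\<^sup>* x\<parallel> / 2\<close>. Since \<open>\<parallel>T x\<parallel> = \<parallel>x\<parallel>\<close>, this forces \<open>T x = T\<^sup>* x\<close>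
  as soon as \<open>\<parallel>T\<^sup>* x\<parallel> \<le> \<parallel>x\<parallel>\<close>. For \<open>y \<in> G\<close> the vector \<open>x = S y\<close> is of this kind, with
  \<open>T\<^sup>* x = T\<^sup>* T y = y\<close>, and we get \<open>S\<^sup>2 = I\<close>. Then \<open>S\<^sup>* R = 0\<close> forces \<open>R = 0\<close>, the
  contraction \<open>Q\<close> is isometric because \<open>T\<^sup>*T \<ge> I\<close>, and \<open>T\<close> is an isometry; the same argument
  now applies to every \<open>x\<close>.\<close>

section \<open>Complex inner products\<close>

lemma cinner_add_right: "cinner x (y + z) = cinner x y + cinner (x::'a::complex_inner) z"
  by (metis cinner_add_left cinner_commute complex_cnj_add)

lemma cinner_scaleC_right: "cinner x (scaleC c y) = cnj c * cinner (x::'a::complex_inner) y"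
  by (metis cinner_commute cinner_scaleC_left complex_cnj_mult)

lemma cinner_scaleR_left: "cinner (r *\<^sub>R x) y = r *\<^sub>R cinner (x::'a::complex_inner) y"
  by (metis cinner_scaleC_left scaleC_of_real scaleR_conv_of_real)

lemma cinner_scaleR_right: "cinner x (r *\<^sub>R y) = r *\<^sub>R cinner (x::'a::complex_inner) y"
  by (metis cinner_scaleC_right scaleC_of_real scaleR_conv_of_real complex_cnj_complex_of_real)

lemma scaleC_scaleR: "scaleC c (r *\<^sub>R x) = r *\<^sub>R scaleC c (x::'a::complex_inner)"
  by (metis mult.commute scaleC_of_real scaleC_scaleC)

lemma scaleC_diff_right: "scaleC c (x - y) = scaleC c x - scaleC c (y::'a::complex_inner)"
  by (metis add_diff_cancel_right' diff_add_cancel scaleC_add_right)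

lemma Re_cinner_self [simp]: "Re (cinner x x) = (norm (x::'a::complex_inner))\<^sup>2"
  by (simp add: cinner_norm)

lemma Re_cinner_commute: "Re (cinner x y) = Re (cinner y (x::'a::complex_inner))"
  by (metis cinner_commute complex_cnj(1) cnj.sel(1))

lemma cinner_self_eq_0_iff [simp]: "cinner x x = 0 \<longleftrightarrow> (x::'a::complex_inner) = 0"
  by (simp add: cinner_norm)

lemma norm_add_sq:
  "(norm (x + y))\<^sup>2 = (norm x)\<^sup>2 + (norm y)\<^sup>2 + 2 * Re (cinner x (y::'a::complex_inner))"
proof -
  have "(norm (x + y))\<^sup>2 = Re (cinner (x + y) (x + y))" by simp
  also have "\<dots> = (norm x)\<^sup>2 + (norm y)\<^sup>2 + Re (cinner x y) + Re (cinner y x)"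
    by (simp only: cinner_add_left cinner_add_right plus_complex.sel Re_cinner_self)
  finally show ?thesis by (simp add: Re_cinner_commute[of y x])
qed

lemma norm_add_scaleR_sq:
  "(norm (x + t *\<^sub>R y))\<^sup>2 =
     (norm x)\<^sup>2 + t\<^sup>2 * (norm y)\<^sup>2 + 2 * t * Re (cinner x (y::'a::complex_inner))"
  by (simp add: norm_add_sq cinner_scaleR_right power_mult_distrib)

lemma norm_diff_sq:
  "(norm (x - y))\<^sup>2 = (norm x)\<^sup>2 + (norm y)\<^sup>2 - 2 * Re (cinner x (y::'a::complex_inner))"
  using norm_add_scaleR_sq[of x "-1" y] by simp

lemma parallelogram_law:
  "(norm (x + y))\<^sup>2 + (norm (x - y))\<^sup>2 = 2 * (norm x)\<^sup>2 + 2 * (norm (y::'a::complex_inner))\<^sup>2"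
  by (simp add: norm_add_sq norm_diff_sq)

text \<open>The class assumes homogeneity of the norm for real scalars only; the complex case comes
  out of \<open>cinner_norm\<close>.\<close>

lemma norm_scaleC: "norm (scaleC c x) = cmod c * norm (x::'a::complex_inner)"
proof -
  have "complex_of_real ((norm (scaleC c x))\<^sup>2) = complex_of_real ((cmod c * norm x)\<^sup>2)"
    unfolding cinner_norm[symmetric] cinner_scaleC_left cinner_scaleC_right
    by (simp add: cinner_norm power_mult_distrib complex_norm_square del: of_real_power)
  then show ?thesis
    by (simp only: of_real_eq_iff power2_eq_iff_nonneg norm_ge_zero mult_nonneg_nonneg)
qed

lemma Re_cinner_le: "Re (cinner x y) \<le> norm x * norm (y::'a::complex_inner)"
proof (cases "x = 0 \<or> y = 0")
  case True
  have "cinner 0 y = 0" "cinner x 0 = 0"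
    using cinner_scaleR_left[of 0 0 y] cinner_scaleR_right[of x 0 0] by simp_all
  with True show ?thesis by auto
next
  case False
  \<comment> \<open>\<open>u\<close> and \<open>v\<close> are the two vectors rescaled to the common
    norm \<open>norm x * norm y\<close>; their squared distance then has the factor
    \<open>norm x * norm y - Re (cinner x y)\<close>.\<close>
  define u where "u = norm y *\<^sub>R x"
  define v where "v = norm x *\<^sub>R y"
  have "0 \<le> (norm (u - v))\<^sup>2" by simp
  also have "\<dots> = 2 * (norm x * norm y) * (norm x * norm y - Re (cinner x y))"
    unfolding norm_diff_sq u_def v_def
    by (simp add: cinner_scaleR_left cinner_scaleR_right power2_eq_square algebra_simps)
  finally show ?thesis
    using False by (simp add: zero_le_mult_iff mult_le_0_iff)
qed

lemma norm_cinner_le: "cmod (cinner x y) \<le> norm x * norm (y::'a::complex_inner)"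
proof (cases "cinner x y = 0")
  case False
  \<comment> \<open>The phase that rotates the inner product onto the nonnegative real axis, which
    reduces the claim to \<open>Re_cinner_le\<close>.\<close>
  define c where "c = cnj (cinner x y) / cmod (cinner x y)"
  have "cmod c = 1" using False by (simp add: c_def norm_divide)
  have "c * cinner x y = cmod (cinner x y)"
    using False by (simp add: c_def mult.commute power2_eq_square flip: complex_norm_square)
  then have "cmod (cinner x y) = Re (cinner (scaleC c x) y)"
    by (simp add: cinner_scaleC_left)
  also have "\<dots> \<le> norm x * norm y"
    using Re_cinner_le[of "scaleC c x" y] \<open>cmod c = 1\<close> by (simp add: norm_scaleC)
  finally show ?thesis .
qed simp

interpretation cinner: bounded_bilinear "cinner :: 'a::complex_inner \<Rightarrow> 'a \<Rightarrow> complex"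
proof
  show "\<exists>K. \<forall>a b::'a. norm (cinner a b) \<le> norm a * norm b * K"
    using norm_cinner_le by (intro exI[of _ 1]) auto
qed (simp_all add: cinner_add_left cinner_add_right cinner_scaleR_left cinner_scaleR_right)

lemma bounded_linear_scaleC: "bounded_linear (scaleC c :: 'a::complex_inner \<Rightarrow> 'a)"
  by (rule bounded_linear_intro[where K = "cmod c"])
    (simp_all add: scaleC_add_right scaleC_scaleR norm_scaleC mult.commute)

lemma cinner_eqI:
  assumes "\<And>z. cinner z x = cinner z (y::'a::complex_inner)"
  shows "x = y"
  using assms[of "x - y"] by (metis cinner.diff_right cinner_self_eq_0_iff eq_iff_diff_eq_0)

\<comment> \<open>In a Banach space norm-summable series converge; the limit of
  \<open>sqrt_iter\<close> relies on this.\<close>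
subclass (in chilbert_space) banach ..

section \<open>Riesz representation and adjoints\<close>

lemma closed_csubspaceD:
  assumes "closed_csubspace M"
  shows "0 \<in> M" "x \<in> M \<Longrightarrow> y \<in> M \<Longrightarrow> x + y \<in> M" "x \<in> M \<Longrightarrow> scaleC c x \<in> M"
    "x \<in> M \<Longrightarrow> r *\<^sub>R x \<in> M" "x \<in> M \<Longrightarrow> y \<in> M \<Longrightarrow> x - y \<in> M" "closed M"
proof -
  show *: "0 \<in> M" "x \<in> M \<Longrightarrow> y \<in> M \<Longrightarrow> x + y \<in> M" "x \<in> M \<Longrightarrow> scaleC c x \<in> M" "closed M"
    for x y c
    using assms by (auto simp: closed_csubspace_def)
  show **: "x \<in> M \<Longrightarrow> r *\<^sub>R x \<in> M" for x r
    using *(3)[of x "complex_of_real r"] by (simp add: scaleC_of_real)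
  show "x \<in> M \<Longrightarrow> y \<in> M \<Longrightarrow> x - y \<in> M"
    using *(2)[of x "(-1) *\<^sub>R y"] **[of y "-1"] by simp
qed

lemma closed_csubspace_UNIV: "closed_csubspace UNIV"
  by (simp add: closed_csubspace_def)

text \<open>First-variation argument: for small \<open>t\<close> of sign opposite to
  \<open>a\<close> the linear term would win. It gives the stationarity condition of a
  minimiser.\<close>

lemma linear_le_quadratic_imp_zero:
  fixes a b :: real
  assumes "\<And>t. 0 \<le> t\<^sup>2 * b + 2 * t * a"
  shows "a = 0"
proof (rule ccontr)
  assume "a \<noteq> 0"
  \<comment> \<open>With this \<open>s\<close> the linear term \<open>2 * s * a\<close> equals
    \<open>-2 * s\<^sup>2 * (\<bar>b\<bar> + 1)\<close>, which outweighs
    \<open>s\<^sup>2 * b\<close>.\<close>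
  define s where "s = - a / (\<bar>b\<bar> + 1)"
  have "s * (\<bar>b\<bar> + 1) = - a" by (simp add: s_def)
  then have "s\<^sup>2 * \<bar>b\<bar> + s\<^sup>2 = - (s * a)"
    by (metis distrib_left mult.assoc mult.right_neutral mult_minus_right power2_eq_square)
  moreover have "s\<^sup>2 > 0" using \<open>a \<noteq> 0\<close> by (simp add: s_def)
  moreover have "s\<^sup>2 * b \<le> s\<^sup>2 * \<bar>b\<bar>" by (intro mult_left_mono) auto
  moreover have "s\<^sup>2 * \<bar>b\<bar> \<ge> 0" by simp
  ultimately show False
    using assms[of s] by linarith
qed

text \<open>The representing vector minimises \<open>J x = \<parallel>x\<parallel>\<^sup>2 - 2 Re (f x)\<close> on \<open>M\<close>; minimising sequences
  are Cauchy by the parallelogram law.\<close>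

lemma riesz_representation:
  fixes f :: "'a::chilbert_space \<Rightarrow> complex"
  assumes M: "closed_csubspace M"
    and add: "\<And>x y. x \<in> M \<Longrightarrow> y \<in> M \<Longrightarrow> f (x + y) = f x + f y"
    and scale: "\<And>c x. x \<in> M \<Longrightarrow> f (scaleC c x) = c * f x"
    and bound: "\<And>x. x \<in> M \<Longrightarrow> cmod (f x) \<le> K * norm x"
  shows "\<exists>z\<in>M. \<forall>x\<in>M. f x = cinner x z"
proof -
  note sub = closed_csubspaceD[OF M]
  have scaleR: "f (r *\<^sub>R x) = r * f x" if "x \<in> M" for r x
    using scale[OF that, of "complex_of_real r"] by (simp add: scaleC_of_real)
  have diff: "f (x - y) = f x - f y" if "x \<in> M" "y \<in> M" for x y
    using add[of x "(-1) *\<^sub>R y"] scaleR[of y "-1"] that sub(4)[of y "-1"] by simp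
  define J where "J x = (norm x)\<^sup>2 - 2 * Re (f x)" for x
  \<comment> \<open>The constant comes from completing the square in \<open>norm x\<close>.\<close>
  have J_below: "J x \<ge> - K\<^sup>2" if "x \<in> M" for x
  proof -
    have "Re (f x) \<le> K * norm x"
      using bound[OF that] complex_Re_le_cmod order_trans by blast
    moreover have "0 \<le> (norm x - K)\<^sup>2" by simp
    ultimately show ?thesis by (simp add: J_def power2_eq_square algebra_simps)
  qed
  define m where "m = Inf (J ` M)"
  have bdd: "bdd_below (J ` M)" using J_below by (intro bdd_belowI2) auto
  have m_le: "m \<le> J x" if "x \<in> M" for x
    unfolding m_def using bdd that by (rule cINF_lower)
  have "\<exists>x\<in>M. J x < m + inverse (real (Suc n))" for n
    using cINF_less_iff[OF _ bdd, of "m + inverse (real (Suc n))"] sub(1)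
    unfolding m_def by auto
  then obtain X where X: "\<And>n. X n \<in> M" "\<And>n. J (X n) < m + inverse (real (Suc n))"
    by metis
  \<comment> \<open>By the parallelogram law the left side is
    \<open>2 * J x + 2 * J y - 4 * J w\<close> for the midpoint \<open>w\<close>, and
    \<open>J w\<close> is at least \<open>m\<close>.\<close>
  have par: "(norm (x - y))\<^sup>2 \<le> 2 * (J x - m) + 2 * (J y - m)" if "x \<in> M" "y \<in> M" for x y
  proof -
    define w where "w = (1/2) *\<^sub>R (x + y)"
    have "w \<in> M" unfolding w_def by (intro sub that)
    have fw: "f w = (f x + f y) / 2"
      unfolding w_def using scaleR[of "x + y" "1/2"] add that sub(2) by simp
    have "Re (f w) = (Re (f x) + Re (f y)) / 2" unfolding fw by simp
    moreover have "(norm w)\<^sup>2 = (norm (x + y))\<^sup>2 / 4" by (simp add: w_def power_divide)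
    ultimately have "4 * J w = (norm (x + y))\<^sup>2 - 4 * Re (f x) - 4 * Re (f y)"
      unfolding J_def by simp
    with parallelogram_law[of x y] m_le[OF \<open>w \<in> M\<close>] show ?thesis
      unfolding J_def by simp
  qed
  have "Cauchy X"
  proof (rule metric_CauchyI)
    fix e :: real assume "e > 0"
    then obtain N where N: "inverse (real (Suc N)) < e\<^sup>2 / 4"
      using reals_Archimedean[of "e\<^sup>2 / 4"] by auto
    have small: "J (X n) - m < e\<^sup>2 / 4" if "n \<ge> N" for n
    proof -
      have "inverse (real (Suc n)) \<le> inverse (real (Suc N))" using that by simp
      then show ?thesis using X(2)[of n] N by linarith
    qed
    have "dist (X i) (X j) < e" if "i \<ge> N" "j \<ge> N" for i j
    proof -
      have "2 * (J (X i) - m) + 2 * (J (X j) - m) < e\<^sup>2"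
        using small[OF that(1)] small[OF that(2)] by argo
      with par[OF X(1) X(1)] have "(norm (X i - X j))\<^sup>2 < e\<^sup>2" by (rule le_less_trans)
      then show ?thesis
        using \<open>e > 0\<close> by (simp add: dist_norm power_less_imp_less_base)
    qed
    then show "\<exists>N. \<forall>i\<ge>N. \<forall>j\<ge>N. dist (X i) (X j) < e" by blast
  qed
  then obtain z where z: "X \<longlonglongrightarrow> z"
    using Cauchy_convergent_iff convergent_def by blast
  have zM: "z \<in> M"
    using closed_sequentially[OF sub(6) _ z] X(1) by blast
  have "(\<lambda>n. f (X n)) \<longlonglongrightarrow> f z"
  proof (rule LIM_zero_cancel, rule Lim_null_comparison)
    show "\<forall>\<^sub>F n in sequentially. norm (f (X n) - f z) \<le> K * norm (X n - z)"
      using bound[OF sub(5)[OF X(1) zM]] diff[OF X(1) zM] by simp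
    have "(\<lambda>n. K * norm (X n - z)) \<longlonglongrightarrow> K * norm (z - z)"
      by (intro tendsto_intros z)
    then show "(\<lambda>n. K * norm (X n - z)) \<longlonglongrightarrow> 0" by simp
  qed
  then have "(\<lambda>n. J (X n)) \<longlonglongrightarrow> J z"
    unfolding J_def by (intro tendsto_intros z)
  moreover have "(\<lambda>n. m + inverse (real (Suc n))) \<longlonglongrightarrow> m + 0"
    by (intro tendsto_intros LIMSEQ_inverse_real_of_nat)
  ultimately have "J z \<le> m + 0"
    by (rule LIMSEQ_le) (use X(2) less_imp_le in blast)
  then have Jz: "J z \<le> m" by simp
  have re: "Re (f x) = Re (cinner x z)" if "x \<in> M" for x
  proof -
    \<comment> \<open>The right side is the increase of \<open>J\<close> from the minimiser
      \<open>z\<close> to \<open>z + t *\<^sub>R x\<close>.\<close>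
    have "0 \<le> t\<^sup>2 * (norm x)\<^sup>2 + 2 * t * (Re (cinner z x) - Re (f x))" for t
    proof -
      have "f (z + t *\<^sub>R x) = f z + t * f x"
        using add[OF zM sub(4)[OF that]] scaleR[OF that] by simp
      then have "J (z + t *\<^sub>R x) - J z = t\<^sup>2 * (norm x)\<^sup>2 + 2 * t * (Re (cinner z x) - Re (f x))"
        unfolding J_def norm_add_scaleR_sq by (simp add: algebra_simps)
      moreover have "J z \<le> J (z + t *\<^sub>R x)"
        using Jz m_le[OF sub(2)[OF zM sub(4)[OF that]]] by (rule order_trans)
      ultimately show ?thesis by linarith
    qed
    from linear_le_quadratic_imp_zero[OF this] show ?thesis
      using Re_cinner_commute[of x z] by simp
  qed
  \<comment> \<open>The imaginary parts are read off from the real parts at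
    \<open>scaleC \<i> x\<close>.\<close>
  have "f x = cinner x z" if "x \<in> M" for x
    using re[OF that] re[OF sub(3)[OF that, of \<i>]] scale[OF that, of \<i>]
    by (simp add: complex_eq_iff cinner_scaleC_left)
  with zM show ?thesis by blast
qed

text \<open>Justifies the definite description in \<open>adj_on\<close>. Riesz applies because the
  functional is bounded by \<open>K * norm y\<close>; the difference of two candidates lies in
  \<open>M\<close> and is orthogonal to itself.\<close>

lemma adj_on_works:
  fixes A :: "'a::chilbert_space \<Rightarrow> 'a"
  assumes M: "closed_csubspace M" and A: "bounded_op M N A"
  shows "adj_on M A y \<in> M \<and> (\<forall>x\<in>M. cinner (A x) y = cinner x (adj_on M A y))"
proof -
  obtain K where K: "\<And>x. x \<in> M \<Longrightarrow> norm (A x) \<le> K * norm x"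
    using A unfolding bounded_op_def by blast
  have "\<exists>z\<in>M. \<forall>x\<in>M. cinner (A x) y = cinner x z"
  proof (rule riesz_representation[OF M])
    fix x assume "x \<in> M"
    have "cmod (cinner (A x) y) \<le> norm (A x) * norm y" by (rule norm_cinner_le)
    also have "\<dots> \<le> (K * norm x) * norm y" by (intro mult_right_mono K \<open>x \<in> M\<close>) simp
    finally show "cmod (cinner (A x) y) \<le> (K * norm y) * norm x" by (simp add: ac_simps)
  qed (use A in \<open>auto simp: bounded_op_def cinner_add_left cinner_scaleC_left\<close>)
  then obtain z where z: "z \<in> M" "\<forall>x\<in>M. cinner (A x) y = cinner x z" by blast
  show ?thesis
    unfolding adj_on_def
  proof (rule theI)
    fix w assume w: "w \<in> M \<and> (\<forall>x\<in>M. cinner (A x) y = cinner x w)"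
    have "w - z \<in> M" using w z closed_csubspaceD(5)[OF M] by blast
    then have "cinner (w - z) (w - z) = 0"
      using w z by (subst cinner.diff_right) force
    then show "w = z" by simp
  qed (use z in blast)
qed

text \<open>The component in \<open>M\<close> is the vector that represents, on \<open>M\<close>,
  the functional given by the inner product with \<open>x\<close>.\<close>

lemma ortho_decomposition:
  fixes x :: "'a::chilbert_space"
  assumes "closed_csubspace M"
  obtains g h where "g \<in> M" "h \<in> ortho_compl M" "x = g + h"
proof -
  have "\<exists>g\<in>M. \<forall>v\<in>M. cinner v x = cinner v g"
    using norm_cinner_le[of _ x]
    by (intro riesz_representation[OF assms, where K = "norm x"])
      (simp_all add: cinner_add_left cinner_scaleC_left mult.commute)
  then obtain g where "g \<in> M" "\<forall>v\<in>M. cinner v x = cinner v g" by blast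
  then show ?thesis
    by (intro that[of g "x - g"]) (auto simp: ortho_compl_def cinner.diff_right)
qed

section \<open>Bounded and positive operators\<close>

text \<open>Makes the facts about \<open>bounded_linear\<close> available; complex homogeneity is
  carried along separately.\<close>

lemma bounded_op_UNIV_iff:
  "bounded_op UNIV UNIV A \<longleftrightarrow>
     bounded_linear A \<and> (\<forall>c x. A (scaleC c x) = scaleC c (A (x::'a::complex_inner)))"
proof
  assume A: "bounded_op UNIV UNIV A"
  then obtain K where "\<And>x. norm (A x) \<le> K * norm x" by (auto simp: bounded_op_def)
  moreover have "A (r *\<^sub>R x) = r *\<^sub>R A x" for r x
    using A by (simp add: bounded_op_def flip: scaleC_of_real)
  ultimately have "bounded_linear A"
    using A by (intro bounded_linear_intro[where K = K])
      (auto simp: bounded_op_def mult.commute)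
  with A show "bounded_linear A \<and> (\<forall>c x. A (scaleC c x) = scaleC c (A x))"
    by (auto simp: bounded_op_def)
next
  assume A: "bounded_linear A \<and> (\<forall>c x. A (scaleC c x) = scaleC c (A x))"
  then interpret bounded_linear A by blast
  show "bounded_op UNIV UNIV A"
    using A bounded by (auto simp: bounded_op_def add mult.commute)
qed

lemma
  fixes T :: "'a::chilbert_space \<Rightarrow> 'a"
  assumes T: "bounded_op UNIV UNIV T"
  shows cinner_adj_right: "cinner x (adj T y) = cinner (T x) y"
    and cinner_adj_left: "cinner (adj T x) y = cinner x (T y)"
proof -
  show *: "cinner x (adj T y) = cinner (T x) y" for x y
    using adj_on_works[OF closed_csubspace_UNIV T] by simp
  show "cinner (adj T x) y = cinner x (T y)"
    using * by (metis cinner_commute)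
qed

lemma bounded_op_adj:
  fixes T :: "'a::chilbert_space \<Rightarrow> 'a"
  assumes T: "bounded_op UNIV UNIV T"
  shows "bounded_op UNIV UNIV (adj T)"
proof -
  note adj = cinner_adj_right[OF T] cinner_adj_left[OF T]
  obtain K where K: "\<And>x. norm (T x) \<le> K * norm x"
    using T by (auto simp: bounded_op_def)
  have add: "adj T (x + y) = adj T x + adj T y" for x y
    by (rule cinner_eqI) (simp add: adj cinner_add_right)
  have scale: "adj T (scaleC c x) = scaleC c (adj T x)" for c x
    by (rule cinner_eqI) (simp add: adj cinner_scaleC_right)
  have "norm (adj T x) \<le> K * norm x" for x
  proof (cases "adj T x = 0")
    case False
    have "(norm (adj T x))\<^sup>2 = Re (cinner (T (adj T x)) x)"
      by (simp flip: adj(1))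
    also have "\<dots> \<le> norm (T (adj T x)) * norm x" by (rule Re_cinner_le)
    also have "\<dots> \<le> (K * norm (adj T x)) * norm x" by (intro mult_right_mono K) simp
    finally have "norm (adj T x) * norm (adj T x) \<le> norm (adj T x) * (K * norm x)"
      by (simp add: power2_eq_square ac_simps)
    with False show ?thesis by simp
  next
    case True
    have "0 \<le> norm (T x)" by simp
    also have "\<dots> \<le> K * norm x" by (rule K)
    finally show ?thesis using True by simp
  qed
  with add scale show ?thesis by (auto simp: bounded_op_def)
qed

lemma bounded_op_comp:
  "bounded_op UNIV UNIV A \<Longrightarrow> bounded_op UNIV UNIV B \<Longrightarrow> bounded_op UNIV UNIV (A \<circ> B)"
  unfolding bounded_op_UNIV_iff by (simp add: bounded_linear_compose o_def)

lemma bounded_op_Re: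
  fixes T :: "'a::chilbert_space \<Rightarrow> 'a"
  assumes "bounded_op UNIV UNIV T"
  shows "bounded_op UNIV UNIV (Re_op T)"
  using assms bounded_op_adj[OF assms] unfolding bounded_op_UNIV_iff Re_op_def
  by (auto intro!: bounded_linear_intros bounded_linear_add
      bounded_linear_compose[OF bounded_linear_scaleR_right]
      simp: scaleC_scaleR scaleC_add_right)

lemma positive_opD:
  assumes "positive_op P"
  shows "bounded_op UNIV UNIV P" "bounded_linear P" "0 \<le> Re (cinner (P x) x)"
    "Im (cinner (P x) x) = 0"
  using assms by (auto simp: positive_op_def bounded_op_UNIV_iff complex_nonneg_Reals_iff)

lemma positive_opI:
  assumes "bounded_op UNIV UNIV P" "\<And>x y. cinner (P x) y = cinner x (P y)"
    "\<And>x. 0 \<le> Re (cinner (P x) x)"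
  shows "positive_op P"
proof -
  have "Im (cinner (P x) x) = 0" for x
    using assms(2)[of x x] cinner_commute[of x "P x"]
    by (metis Reals_cnj_iff complex_is_Real_iff)
  with assms show ?thesis by (simp add: positive_op_def complex_nonneg_Reals_iff)
qed

text \<open>Polarisation: the quadratic form is real at \<open>x + y\<close> and at
  \<open>x + scaleC \<i> y\<close>, which fixes the imaginary and the real part
  respectively.\<close>

lemma positive_op_symmetric:
  assumes "positive_op P"
  shows "cinner (P x) y = cinner x (P y)"
proof -
  note P = positive_opD[OF assms]
  interpret bounded_linear P by (rule P)
  have "Im (cinner (P x) y + cinner (P y) x) = 0"
    using P(4)[of "x + y"] P(4)[of x] P(4)[of y]
    by (simp add: add cinner_add_left cinner_add_right)
  moreover have "P (scaleC \<i> y) = scaleC \<i> (P y)"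
    using P(1) by (simp add: bounded_op_def)
  then have "Im (\<i> * cinner (P y) x - \<i> * cinner (P x) y) = 0"
    using P(4)[of "x + scaleC \<i> y"] P(4)[of x] P(4)[of y]
    by (simp add: add cinner_add_left cinner_add_right cinner_scaleC_left cinner_scaleC_right)
  ultimately have "cinner (P x) y = cnj (cinner (P y) x)"
    by (simp add: complex_eq_iff)
  then show ?thesis by (metis cinner_commute)
qed

text \<open>Positivity is applied to the vector \<open>K *\<^sub>R x - P x\<close>. By symmetry both
  mixed terms are \<open>(norm (P x))\<^sup>2\<close>, and the last term of the expansion is at most
  \<open>K\<close> times this square.\<close>

lemma positive_op_norm_sq_le:
  assumes P: "positive_op P" and K: "\<And>x. norm (P x) \<le> K * norm x" "K > 0"
  shows "(norm (P x))\<^sup>2 \<le> K * Re (cinner (P x) x)"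
proof -
  interpret bounded_linear P by (rule positive_opD[OF P])
  define u where "u = P x"
  have "0 \<le> Re (cinner (P (K *\<^sub>R x - u)) (K *\<^sub>R x - u))" by (rule positive_opD[OF P])
  also have "\<dots> = K\<^sup>2 * Re (cinner (P x) x) - K * Re (cinner (P x) u) - K * Re (cinner (P u) x)
      + Re (cinner (P u) u)"
    by (simp add: diff scaleR cinner.diff_left cinner.diff_right cinner_scaleR_left
        cinner_scaleR_right power2_eq_square algebra_simps)
  also have "cinner (P u) x = cinner u u"
    unfolding positive_op_symmetric[OF P] u_def ..
  also have "Re (cinner (P u) u) \<le> K * (norm u)\<^sup>2"
    using Re_cinner_le[of "P u" u] mult_right_mono[OF K(1)[of u], of "norm u"]
    by (simp add: power2_eq_square algebra_simps)
  finally have "K * (norm u)\<^sup>2 \<le> K * (K * Re (cinner (P x) x))"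
    by (simp add: u_def power2_eq_square algebra_simps)
  then show ?thesis using K(2) by (simp add: u_def)
qed

lemma positive_op_pos_bound:
  assumes "positive_op P"
  obtains K where "K > 0" "\<And>x. norm (P x) \<le> K * norm x"
  using bounded_linear.pos_bounded[OF positive_opD(2)[OF assms]]
  by (auto simp: mult.commute)

lemma positive_op_eq_0:
  assumes P: "positive_op P" and "Re (cinner (P x) x) = 0"
  shows "P x = 0"
proof -
  obtain K where K: "K > 0" "\<And>x. norm (P x) \<le> K * norm x"
    using positive_op_pos_bound[OF P] by blast
  show ?thesis using positive_op_norm_sq_le[OF P K(2,1), of x] assms(2) by simp
qed

text \<open>\<open>P\<^sup>2 - 1\<close> factors as \<open>(P + 1) (P - 1)\<close>, and
  \<open>P + 1\<close> is injective because a positive \<open>P\<close> cannot have the eigenvalue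
  \<open>-1\<close>.\<close>

lemma positive_op_sq_fixed:
  assumes P: "positive_op P" and "P (P x) = x"
  shows "P x = x"
proof -
  interpret bounded_linear P by (rule positive_opD[OF P])
  define u where "u = P x - x"
  have "P u = - u" by (simp add: u_def diff assms(2))
  then have "(norm u)\<^sup>2 \<le> 0"
    using positive_opD(3)[OF P, of u] by (simp add: cinner.minus_left)
  then show ?thesis by (simp add: u_def)
qed

section \<open>The positive square root\<close>

text \<open>If \<open>Y = (B + Y\<^sup>2) / 2\<close> then \<open>(1 - Y)\<^sup>2 = 1 - B\<close>. For a contraction \<open>B\<close> the fixed point
  iteration is majorised by the same iteration for the number \<open>1\<close>.\<close>

primrec sqrt_iter :: "('a::real_vector \<Rightarrow> 'a) \<Rightarrow> nat \<Rightarrow> 'a \<Rightarrow> 'a" where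
  "sqrt_iter B 0 x = 0"
| "sqrt_iter B (Suc n) x = (1/2) *\<^sub>R (B x + sqrt_iter B n (sqrt_iter B n x))"

primrec sqrt_bound :: "nat \<Rightarrow> real" where
  "sqrt_bound 0 = 0"
| "sqrt_bound (Suc n) = (1 + (sqrt_bound n)\<^sup>2) / 2"

lemma sqrt_bound_nonneg: "0 \<le> sqrt_bound n"
  by (cases n) auto

lemma sqrt_bound_le_1: "sqrt_bound n \<le> 1"
proof (induction n)
  case (Suc n)
  then show ?case using power_le_one[OF sqrt_bound_nonneg, of n 2] by simp
qed simp

lemma sqrt_bound_mono: "sqrt_bound n \<le> sqrt_bound (Suc n)"
proof -
  have "0 \<le> (sqrt_bound n - 1)\<^sup>2" by simp
  then show ?thesis by (simp add: power2_eq_square algebra_simps)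
qed

lemma bounded_op_sqrt_iter:
  fixes B :: "'a::complex_inner \<Rightarrow> 'a"
  assumes "bounded_op UNIV UNIV B"
  shows "bounded_op UNIV UNIV (sqrt_iter B n)"
proof (induction n)
  case 0
  have "scaleC c (0::'a) = 0" for c
    using bounded_linear.linear[OF bounded_linear_scaleC] linear_0 by blast
  then show ?case by (auto simp: bounded_op_def intro: exI[of _ 0])
next
  case (Suc n)
  with assms show ?case
    unfolding bounded_op_UNIV_iff sqrt_iter.simps
    by (auto intro!: bounded_linear_add bounded_linear_compose[of "sqrt_iter B n"]
        bounded_linear_compose[OF bounded_linear_scaleR_right]
        simp: scaleC_scaleR scaleC_add_right)
qed

lemma norm_sqrt_iter_le:
  assumes "\<And>x::'a::real_normed_vector. norm (B x) \<le> norm x"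
  shows "norm (sqrt_iter B n x) \<le> sqrt_bound n * norm x"
proof (induction n arbitrary: x)
  case (Suc n)
  let ?Y = "sqrt_iter B n"
  have "norm (?Y (?Y x)) \<le> sqrt_bound n * norm (?Y x)" by (rule Suc)
  also have "\<dots> \<le> sqrt_bound n * (sqrt_bound n * norm x)"
    by (intro mult_left_mono Suc sqrt_bound_nonneg)
  finally have "norm (B x + ?Y (?Y x)) \<le> norm x + sqrt_bound n * (sqrt_bound n * norm x)"
    using assms[of x] norm_triangle_ineq[of "B x" "?Y (?Y x)"] by linarith
  then show ?case by (simp add: power2_eq_square algebra_simps add_divide_distrib
        flip: scaleR_add_right)
qed simp

text \<open>The increments are dominated by those of the scalar iteration, whose sum telescopes.
  Writing \<open>Y\<^sup>2 - Z\<^sup>2\<close> as \<open>Y (Y - Z) + (Y - Z) Z\<close> yields the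
  factor \<open>a * (a - b) + (a - b) * b\<close>, which is
  \<open>a\<^sup>2 - b\<^sup>2\<close>.\<close>

lemma norm_sqrt_iter_diff_le:
  fixes B :: "'a::complex_inner \<Rightarrow> 'a"
  assumes B: "bounded_op UNIV UNIV B" "\<And>x. norm (B x) \<le> norm x"
  shows "norm (sqrt_iter B (Suc n) x - sqrt_iter B n x)
           \<le> (sqrt_bound (Suc n) - sqrt_bound n) * norm x"
proof (induction n arbitrary: x)
  case 0
  show ?case using B(2)[of x] by simp
next
  case (Suc n)
  define Y Z a b where "Y = sqrt_iter B (Suc n)" and "Z = sqrt_iter B n"
    and "a = sqrt_bound (Suc n)" and "b = sqrt_bound n"
  have IH: "norm (Y x - Z x) \<le> (a - b) * norm x" for x
    unfolding Y_def Z_def a_def b_def by (rule Suc)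
  have nY: "norm (Y x) \<le> a * norm x" and nZ: "norm (Z x) \<le> b * norm x" for x
    unfolding Y_def Z_def a_def b_def by (rule norm_sqrt_iter_le[OF B(2)])+
  have ab: "0 \<le> b" "b \<le> a"
    unfolding a_def b_def by (rule sqrt_bound_nonneg, rule sqrt_bound_mono)
  have YZ: "Y (Y x) - Z (Z x) = Y (Y x - Z x) + (Y (Z x) - Z (Z x))"
    using bounded_op_sqrt_iter[OF B(1), of "Suc n"]
    by (simp add: Y_def[symmetric] bounded_op_UNIV_iff bounded_linear.linear linear_diff)
  have "norm (Y (Y x - Z x)) \<le> a * ((a - b) * norm x)"
    using nY[of "Y x - Z x"] mult_left_mono[OF IH[of x], of a] ab by linarith
  moreover have "norm (Y (Z x) - Z (Z x)) \<le> (a - b) * (b * norm x)"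
    using IH[of "Z x"] mult_left_mono[OF nZ[of x], of "a - b"] ab by linarith
  ultimately have "norm (Y (Y x) - Z (Z x)) \<le> a * ((a - b) * norm x) + (a - b) * (b * norm x)"
    unfolding YZ using norm_triangle_ineq[of "Y (Y x - Z x)" "Y (Z x) - Z (Z x)"] by linarith
  also have "\<dots> = (a\<^sup>2 - b\<^sup>2) * norm x"
    by (simp add: power2_eq_square algebra_simps)
  finally have *: "norm (Y (Y x) - Z (Z x)) \<le> (a\<^sup>2 - b\<^sup>2) * norm x" .
  have "sqrt_iter B (Suc (Suc n)) x - sqrt_iter B (Suc n) x = (1/2) *\<^sub>R (Y (Y x) - Z (Z x))"
  proof -
    have "sqrt_iter B (Suc (Suc n)) x = (1/2) *\<^sub>R (B x + Y (Y x))"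
      unfolding Y_def by (rule sqrt_iter.simps)
    moreover have "sqrt_iter B (Suc n) x = (1/2) *\<^sub>R (B x + Z (Z x))"
      unfolding Z_def by (rule sqrt_iter.simps)
    ultimately show ?thesis by (simp only: add_diff_cancel_left flip: scaleR_diff_right)
  qed
  moreover have "sqrt_bound (Suc (Suc n)) - sqrt_bound (Suc n) = (a\<^sup>2 - b\<^sup>2) / 2"
    unfolding sqrt_bound.simps(2)[of "Suc n"] a_def b_def
    by (subst (3) sqrt_bound.simps(2)) (simp add: field_simps)
  ultimately show ?case using * by (simp only: norm_scaleR)
qed

lemma sqrt_iter_symmetric:
  assumes "\<And>x y. cinner (B x) y = cinner x (B y)"
  shows "cinner (sqrt_iter B n x) y = cinner x (sqrt_iter B n y)"
  by (induction n arbitrary: x y)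
    (simp_all add: assms cinner_add_left cinner_add_right cinner_scaleR_left cinner_scaleR_right
      cinner.zero_left cinner.zero_right)

text \<open>The iterates are polynomials in \<open>B\<close>. The property survives in the limit and
  is the key to uniqueness of the square root.\<close>

lemma sqrt_iter_commute:
  assumes "bounded_linear Z" "\<And>x. Z (B x) = B (Z x)"
  shows "Z (sqrt_iter B n x) = sqrt_iter B n (Z x)"
proof -
  interpret bounded_linear Z by fact
  show ?thesis by (induction n arbitrary: x) (simp_all add: assms(2) add scaleR zero)
qed

lemma sqrt_iter_limit:
  fixes B :: "'a::chilbert_space \<Rightarrow> 'a"
  assumes B: "bounded_op UNIV UNIV B" "\<And>x. norm (B x) \<le> norm x"
    and sym: "\<And>x y. cinner (B x) y = cinner x (B y)"
  obtains Y where "bounded_op UNIV UNIV Y" "\<And>x. norm (Y x) \<le> norm x"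
    "\<And>x y. cinner (Y x) y = cinner x (Y y)"
    "\<And>x. Y x = (1/2) *\<^sub>R (B x + Y (Y x))"
    "\<And>Z x. bounded_linear Z \<Longrightarrow> (\<And>x. Z (B x) = B (Z x)) \<Longrightarrow> Z (Y x) = Y (Z x)"
proof -
  let ?I = "sqrt_iter B"
  have "incseq sqrt_bound" using sqrt_bound_mono by (rule incseq_SucI)
  from incseq_convergent[OF this, of 1] have "convergent sqrt_bound"
    using sqrt_bound_le_1
    unfolding convergent_def by blast
  then have sb: "summable (\<lambda>n. sqrt_bound (Suc n) - sqrt_bound n)"
    using telescope_summable convergent_def by blast
  have "convergent (\<lambda>n. ?I n x)" for x
  proof -
    have "summable (\<lambda>n. ?I (Suc n) x - ?I n x)"
    proof (rule summable_norm_cancel, rule summable_comparison_test)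
      show "\<exists>N. \<forall>n\<ge>N. norm (norm (?I (Suc n) x - ?I n x))
              \<le> (sqrt_bound (Suc n) - sqrt_bound n) * norm x"
        using norm_sqrt_iter_diff_le[OF B] by (simp del: sqrt_iter.simps sqrt_bound.simps)
      show "summable (\<lambda>n. (sqrt_bound (Suc n) - sqrt_bound n) * norm x)"
        using sb by (rule summable_mult2)
    qed
    \<comment> \<open>The partial sums telescope to the iterates, since the iteration starts at
      \<open>0\<close>.\<close>
    then have "convergent (\<lambda>n. \<Sum>i<n. ?I (Suc i) x - ?I i x)"
      by (simp add: summable_iff_convergent)
    then show ?thesis by (simp only: sum_lessThan_telescope[of "\<lambda>n. ?I n x"] sqrt_iter.simps(1) diff_zero)
  qed
  then obtain Y where Y: "\<And>x. (\<lambda>n. ?I n x) \<longlonglongrightarrow> Y x"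
    unfolding convergent_def by metis
  note bd = bounded_op_sqrt_iter[OF B(1)]
  have lin: "bounded_linear (?I n)" for n using bd by (simp add: bounded_op_UNIV_iff)
  have nI: "norm (?I n x) \<le> norm x" for n x
    using norm_sqrt_iter_le[OF B(2), of n x] mult_right_mono[OF sqrt_bound_le_1, of "norm x" n]
    by simp
  have nY: "norm (Y x) \<le> norm x" for x
    using LIMSEQ_le_const2[OF tendsto_norm[OF Y]] nI by blast
  have "Y (x + y) = Y x + Y y" for x y
    using tendsto_add[OF Y Y, of x y] Y[of "x + y"] bd
    by (simp add: bounded_op_def LIMSEQ_unique)
  moreover have "Y (scaleC c x) = scaleC c (Y x)" for c x
    using bounded_linear.tendsto[OF bounded_linear_scaleC Y, of c x] Y[of "scaleC c x"] bd
    by (simp add: bounded_op_def LIMSEQ_unique)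
  ultimately have bY: "bounded_op UNIV UNIV Y"
    using nY by (auto simp: bounded_op_def intro!: exI[of _ 1])
  have symY: "cinner (Y x) y = cinner x (Y y)" for x y
  proof (rule LIMSEQ_unique)
    show "(\<lambda>n. cinner (?I n x) y) \<longlonglongrightarrow> cinner (Y x) y"
      by (intro cinner.tendsto Y tendsto_const)
    show "(\<lambda>n. cinner (?I n x) y) \<longlonglongrightarrow> cinner x (Y y)"
      unfolding sqrt_iter_symmetric[OF sym] by (intro cinner.tendsto Y tendsto_const)
  qed
  have "(\<lambda>n. ?I n (?I n x)) \<longlonglongrightarrow> Y (Y x)" for x
  proof -
    \<comment> \<open>All iterates are contractions, so the inner argument may be replaced by its
      limit \<open>Y x\<close>.\<close>
    have "(\<lambda>n. ?I n (?I n x - Y x)) \<longlonglongrightarrow> 0"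
      by (rule Lim_null_comparison[of _ "\<lambda>n. norm (?I n x - Y x)"])
        (use nI Y[of x] in \<open>auto simp: tendsto_norm_zero LIM_zero\<close>)
    from tendsto_add[OF this Y[of "Y x"]] show ?thesis
      by (simp add: linear_diff[OF bounded_linear.linear[OF lin]])
  qed
  then have "(\<lambda>n. ?I (Suc n) x) \<longlonglongrightarrow> (1/2) *\<^sub>R (B x + Y (Y x))" for x
    unfolding sqrt_iter.simps by (intro tendsto_intros)
  then have eqY: "Y x = (1/2) *\<^sub>R (B x + Y (Y x))" for x
    using LIMSEQ_unique[OF LIMSEQ_Suc[OF Y]] by blast
  have "Z (Y x) = Y (Z x)" if Z: "bounded_linear Z" "\<And>x. Z (B x) = B (Z x)" for Z x
    using bounded_linear.tendsto[OF Z(1) Y, of x] Y[of "Z x"]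
    by (simp add: sqrt_iter_commute[where Z = Z and B = B] Z LIMSEQ_unique)
  with that bY nY symY eqY show ?thesis by blast
qed

text \<open>With \<open>K\<close> a bound for \<open>A\<close>, the operator
  \<open>B = 1 - A / K\<close> is a contraction by \<open>positive_op_norm_sq_le\<close>. The fixed
  point \<open>Y\<close> of the iteration for \<open>B\<close> gives the root \<open>sqrt K\<close>
  times \<open>1 - Y\<close>.\<close>

lemma positive_sqrt_exists:
  fixes A :: "'a::chilbert_space \<Rightarrow> 'a"
  assumes A: "positive_op A"
  obtains P where "positive_op P" "P \<circ> P = A"
    "\<And>Z x. bounded_linear Z \<Longrightarrow> (\<And>x. Z (A x) = A (Z x)) \<Longrightarrow> Z (P x) = P (Z x)"
proof -
  obtain K where K: "K > 0" "\<And>x. norm (A x) \<le> K * norm x"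
    using positive_op_pos_bound[OF A] by blast
  note A' = positive_opD[OF A]
  define B where "B x = x - (1/K) *\<^sub>R A x" for x
  have "bounded_op UNIV UNIV B"
    using A'(1) unfolding bounded_op_UNIV_iff B_def
    by (auto intro!: bounded_linear_sub bounded_linear_ident
        bounded_linear_compose[OF bounded_linear_scaleR_right]
        simp: scaleC_scaleR scaleC_diff_right)
  moreover have "norm (B x) \<le> norm x" for x
  proof -
    have "(norm (B x))\<^sup>2 = (norm x)\<^sup>2 + ((norm (A x))\<^sup>2 / K - 2 * Re (cinner (A x) x)) / K"
      unfolding B_def norm_diff_sq Re_cinner_commute[of x]
      using K(1) by (simp add: cinner_scaleR_left power_mult_distrib field_simps power2_eq_square)
    also have "(norm (A x))\<^sup>2 / K \<le> Re (cinner (A x) x)"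
      using positive_op_norm_sq_le[OF A K(2,1), of x] K(1) by (simp add: field_simps)
    then have "((norm (A x))\<^sup>2 / K - 2 * Re (cinner (A x) x)) / K \<le> 0"
      using K(1) A'(3)[of x] by (intro divide_nonpos_pos) auto
    finally show ?thesis by (simp add: abs_le_square_iff[symmetric])
  qed
  moreover have "cinner (B x) y = cinner x (B y)" for x y
    by (simp add: B_def cinner.diff_left cinner.diff_right cinner_scaleR_left
        cinner_scaleR_right positive_op_symmetric[OF A])
  ultimately obtain Y where Y: "bounded_op UNIV UNIV Y" "\<And>x. norm (Y x) \<le> norm x"
    "\<And>x y. cinner (Y x) y = cinner x (Y y)"
    "\<And>x. Y x = (1/2) *\<^sub>R (B x + Y (Y x))"
    "\<And>Z x. bounded_linear Z \<Longrightarrow> (\<And>x. Z (B x) = B (Z x)) \<Longrightarrow> Z (Y x) = Y (Z x)"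
    using sqrt_iter_limit by blast
  define P where "P x = sqrt K *\<^sub>R (x - Y x)" for x
  have linY: "linear Y" using Y(1) by (simp add: bounded_op_UNIV_iff bounded_linear.linear)
  have "positive_op P"
  proof (rule positive_opI)
    show "bounded_op UNIV UNIV P"
      using Y(1) unfolding bounded_op_UNIV_iff P_def
      by (auto intro!: bounded_linear_sub bounded_linear_ident
          bounded_linear_compose[OF bounded_linear_scaleR_right]
          simp: scaleC_scaleR scaleC_diff_right)
    show "cinner (P x) y = cinner x (P y)" for x y
      by (simp add: P_def cinner.diff_left cinner.diff_right cinner_scaleR_left
          cinner_scaleR_right Y(3))
    fix x
    have "Re (cinner (Y x) x) \<le> (norm x)\<^sup>2"
      using Re_cinner_le[of "Y x" x] mult_right_mono[OF Y(2)[of x], of "norm x"]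
      by (simp add: power2_eq_square)
    then show "0 \<le> Re (cinner (P x) x)"
      using K(1) by (simp add: P_def cinner.diff_left cinner_scaleR_left)
  qed
  moreover have "P (P x) = A x" for x
  proof -
    have "2 *\<^sub>R Y x = B x + Y (Y x)" by (subst Y(4)) simp
    \<comment> \<open>The left side is \<open>(1 - Y)\<^sup>2\<close> at \<open>x\<close>, and the
      fixed point equation turns it into \<open>x - B x\<close>.\<close>
    then have "x - Y x - (Y x - Y (Y x)) = (1/K) *\<^sub>R A x"
      by (simp add: B_def scaleR_2 algebra_simps)
    moreover have "P (P x) = K *\<^sub>R (x - Y x - (Y x - Y (Y x)))"
      using K(1) by (simp add: P_def linear_diff[OF linY] linear_scale[OF linY]
          flip: scaleR_diff_right)
    ultimately show ?thesis using K(1) by simp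
  qed
  then have "P \<circ> P = A" by (simp add: fun_eq_iff)
  moreover have "Z (P x) = P (Z x)" if Z: "bounded_linear Z" "\<And>x. Z (A x) = A (Z x)" for Z x
  proof -
    interpret bounded_linear Z by (rule Z)
    have "Z (Y x) = Y (Z x)" for x
      by (rule Y(5)) (simp_all add: Z B_def diff scaleR)
    then show ?thesis by (simp add: P_def diff scaleR)
  qed
  ultimately show ?thesis using that by blast
qed

text \<open>Commutation gives \<open>(P + Q) (P - Q) = 0\<close>. So both nonnegative forms vanish
  at \<open>y = P x - Q x\<close>, hence \<open>P y = Q y = 0\<close>, and \<open>y\<close> is
  orthogonal to itself.\<close>

lemma positive_sqrt_unique:
  assumes P: "positive_op P" and Q: "positive_op Q" and eq: "P \<circ> P = Q \<circ> Q"
    and comm: "\<And>x. Q (P x) = P (Q x)"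
  shows "P = Q"
proof
  fix x
  interpret P: bounded_linear P by (rule positive_opD[OF P])
  interpret Q: bounded_linear Q by (rule positive_opD[OF Q])
  define y where "y = P x - Q x"
  have "P y + Q y = 0"
    using fun_cong[OF eq, of x] by (simp add: y_def P.diff Q.diff comm)
  then have "Re (cinner (P y) y) + Re (cinner (Q y) y) = 0"
    by (metis cinner_add_left cinner.zero_left plus_complex.sel(1) zero_complex.sel(1))
  then have "Re (cinner (P y) y) = 0" "Re (cinner (Q y) y) = 0"
    using positive_opD(3)[OF P, of y] positive_opD(3)[OF Q, of y] by linarith+
  then have "P y = 0" "Q y = 0" using positive_op_eq_0 P Q by blast+
  moreover have "cinner y y = cinner x (P y - Q y)"
    by (subst (1) y_def)
      (simp add: cinner.diff_left cinner.diff_right positive_op_symmetric[OF P]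
        positive_op_symmetric[OF Q])
  ultimately have "cinner y y = 0" by (simp add: cinner.zero_right)
  then show "P x = Q x" by (simp add: y_def)
qed

lemma sqrt_op_works:
  fixes A :: "'a::chilbert_space \<Rightarrow> 'a"
  assumes A: "positive_op A"
  shows "positive_op (sqrt_op A) \<and> sqrt_op A \<circ> sqrt_op A = A"
proof -
  obtain P where P: "positive_op P" "P \<circ> P = A"
    "\<And>Z x. bounded_linear Z \<Longrightarrow> (\<And>x. Z (A x) = A (Z x)) \<Longrightarrow> Z (P x) = P (Z x)"
    using positive_sqrt_exists[OF A] by blast
  show ?thesis
    unfolding sqrt_op_def
  proof (rule theI[where P = "\<lambda>P. positive_op P \<and> P \<circ> P = A"])
    fix Q assume Q: "positive_op Q \<and> Q \<circ> Q = A"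
    \<comment> \<open>Any root \<open>Q\<close> commutes with its own square \<open>A\<close>, hence
      with \<open>P\<close>, so the two roots can be compared.\<close>
    have "Q (P x) = P (Q x)" for x
      using Q by (intro P(3)) (auto simp: positive_opD(2))
    then show "Q = P"
      using positive_sqrt_unique[of P Q] P Q by simp
  qed (use P in blast)
qed

section \<open>Absolute values of operators and norm estimates\<close>

lemma positive_op_adj_comp:
  fixes T :: "'a::chilbert_space \<Rightarrow> 'a"
  assumes T: "bounded_op UNIV UNIV T"
  shows "positive_op (adj T \<circ> T)"
  by (rule positive_opI)
    (simp_all add: bounded_op_comp bounded_op_adj T cinner_adj_left cinner_adj_right)

lemma
  fixes T :: "'a::chilbert_space \<Rightarrow> 'a"
  assumes T: "bounded_op UNIV UNIV T"
  shows positive_abs_op: "positive_op (abs_op T)"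
    and abs_op_abs_op: "abs_op T (abs_op T x) = adj T (T x)"
    and norm_abs_op: "norm (abs_op T x) = norm (T x)"
proof -
  note * = sqrt_op_works[OF positive_op_adj_comp[OF T], folded abs_op_def]
  show pos: "positive_op (abs_op T)" using * by blast
  show sq: "abs_op T (abs_op T x) = adj T (T x)" using * by (simp add: fun_eq_iff)
  have "(norm (abs_op T x))\<^sup>2 = Re (cinner (abs_op T (abs_op T x)) x)"
    by (simp only: positive_op_symmetric[OF pos, of "abs_op T x"] Re_cinner_self)
  also have "\<dots> = (norm (T x))\<^sup>2" by (simp add: sq cinner_adj_left T)
  finally show "norm (abs_op T x) = norm (T x)" by simp
qed

lemma op_le_Re_cinner: "op_le A B \<Longrightarrow> Re (cinner (A x) x) \<le> Re (cinner (B x) x)"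
  using positive_opD(3)[of "\<lambda>x. B x - A x" x] by (simp add: op_le_def cinner.diff_left)

text \<open>\<open>x\<close> is fixed by the square of \<open>abs_op T\<close>, hence by
  \<open>abs_op T\<close> itself. The order relation at \<open>x\<close> and Cauchy-Schwarz then
  give the bound, as \<open>abs_op A x\<close> and \<open>A x\<close> have equal norms.\<close>

lemma norm_le_of_abs_op_le:
  fixes T A :: "'a::chilbert_space \<Rightarrow> 'a"
  assumes T: "bounded_op UNIV UNIV T" and A: "bounded_op UNIV UNIV A"
    and le: "op_le (abs_op T) (abs_op A)" and x: "adj T (T x) = x"
  shows "norm x \<le> norm (A x)"
proof -
  have "abs_op T x = x"
    by (rule positive_op_sq_fixed[OF positive_abs_op[OF T]]) (simp add: abs_op_abs_op T x)
  then have "norm x * norm x \<le> Re (cinner (abs_op A x) x)"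
    using op_le_Re_cinner[OF le, of x] by (simp add: power2_eq_square)
  also have "\<dots> \<le> norm (A x) * norm x"
    using Re_cinner_le[of "abs_op A x" x] by (simp add: norm_abs_op A)
  finally show ?thesis by (cases "x = 0") auto
qed

text \<open>Strict convexity of the ball of radius \<open>r\<close>, read off from the parallelogram
  law.\<close>

lemma eq_of_norm_le_norm_mean:
  fixes a b :: "'a::complex_inner"
  assumes "norm a \<le> r" "norm b \<le> r" "r \<le> norm ((1/2) *\<^sub>R (a + b))"
  shows "a = b"
proof -
  have "0 \<le> r" using assms(1) norm_ge_zero order_trans by blast
  then have "(2 * r)\<^sup>2 \<le> (norm (a + b))\<^sup>2" using assms(3) by (intro power_mono) auto
  then have "4 * r\<^sup>2 \<le> (norm (a + b))\<^sup>2" by (simp add: power_mult_distrib)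
  moreover have "(norm a)\<^sup>2 \<le> r\<^sup>2" "(norm b)\<^sup>2 \<le> r\<^sup>2" using assms by (auto intro: power_mono)
  ultimately have "(norm (a - b))\<^sup>2 \<le> 0"
    using parallelogram_law[of a b] by linarith
  then show ?thesis by simp
qed

lemma contraction_on_norm_le:
  assumes "contraction_on M A" "x \<in> M"
  shows "norm (A x) \<le> norm x"
proof (cases "x = 0")
  case False
  obtain K where K: "\<And>x. x \<in> M \<Longrightarrow> norm (A x) \<le> K * norm x"
    using assms(1) unfolding contraction_on_def bounded_op_def by blast
  \<comment> \<open>The supremum in \<open>onorm_on\<close> dominates its members only once the
    quotients are bounded above. At \<open>y = 0\<close> the quotient is \<open>0\<close> by
    convention, whence the maximum with \<open>0\<close>.\<close>
  have "norm (A y) / norm y \<le> max K 0" if "y \<in> M" for y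
    using K[OF that] by (cases "y = 0") (auto simp: field_simps le_max_iff_disj)
  then have "bdd_above ((\<lambda>y. norm (A y) / norm y) ` M)" by (rule bdd_aboveI2)
  then have "norm (A x) / norm x \<le> onorm_on M A"
    unfolding onorm_on_def using assms(2) by (rule cSUP_upper2) simp
  also have "\<dots> \<le> 1" using assms(1) by (simp add: contraction_on_def)
  finally show ?thesis using False by simp
next
  case True
  obtain K where "norm (A x) \<le> K * norm x"
    using assms by (auto simp: contraction_on_def bounded_op_def)
  with True show ?thesis by simp
qed

section \<open>Block operators under the inequality for the real part\<close>

theorem proposition3p8:
  fixes T S R Q :: "'a::chilbert_space \<Rightarrow> 'a" and G :: "'a set"
  assumes "bounded_op UNIV UNIV T"
    and "op_le id (adj T \<circ> T)"
    and "closed_csubspace G"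
    and "block_matrix_form G T S R (\<lambda>_. 0) Q"
    and "isometry_on G S"
    and "\<forall>y\<in>ortho_compl G. adj_on G S (R y) = 0"
    and "contraction_on (ortho_compl G) Q"
    and "op_le (abs_op T) (abs_op (Re_op T))"
  shows "selfadjoint_op T \<and> symmetry_op T"
proof -
  note T = assms(1) and G = assms(3)
  note sub = closed_csubspaceD[OF G]
  note adjT = cinner_adj_left[OF T] cinner_adj_right[OF T]
  interpret T: bounded_linear T using T by (simp add: bounded_op_UNIV_iff)
  have block: "T (x + y) = S x + R y + Q y" "S x \<in> G" "R y \<in> G" "Q y \<in> ortho_compl G"
    if "x \<in> G" "y \<in> ortho_compl G" for x y
    using assms(4) that by (auto simp: block_matrix_form_def bounded_op_def)
  have orth: "cinner x y = 0" "cinner y x = 0" if "x \<in> G" "y \<in> ortho_compl G" for x y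
    using that by (auto simp: ortho_compl_def) (metis cinner_commute complex_cnj_zero)
  have zero: "0 \<in> ortho_compl G" by (simp add: ortho_compl_def cinner.zero_right)
  have bS: "bounded_op G G S" and nS: "\<And>x. x \<in> G \<Longrightarrow> norm (S x) = norm x"
    using assms(5) by (auto simp: isometry_on_def)
  have S0: "S 0 = 0" using nS[OF sub(1)] by simp
  have nQ: "norm (Q y) \<le> norm y" if "y \<in> ortho_compl G" for y
    using contraction_on_norm_le[OF assms(7) that] .
  have TG: "T x = S x" if "x \<in> G" for x
  proof -
    \<comment> \<open>The block form at \<open>0\<close> identifies \<open>R 0 + Q 0\<close> with
      \<open>T 0\<close>.\<close>
    have "T x = S x + T 0"
      using block(1)[OF that zero] block(1)[OF sub(1) zero] S0 by simp
    then show ?thesis by (simp add: T.zero)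
  qed
  have TH: "T y = R y + Q y" if "y \<in> ortho_compl G" for y
    using block(1)[OF sub(1) that] S0 by simp
  have SR: "cinner (S x) (R y) = 0" if "x \<in> G" "y \<in> ortho_compl G" for x y
    using adj_on_works[OF G bS, of "R y"] assms(6) that by (simp add: cinner.zero_right)
  have ge: "norm x \<le> norm (T x)" for x
    using op_le_Re_cinner[OF assms(2), of x] by (simp add: adjT)

  text \<open>\<open>T\<^sup>*T - I\<close> is positive, so its kernel consists of the vectors on which \<open>T\<close> is isometric.\<close>
  have fixed: "adj T (T x) = x" if "norm (T x) = norm x" for x
  proof -
    have "positive_op (\<lambda>x. (adj T \<circ> T) x - id x)" using assms(2) by (simp add: op_le_def)
    moreover have "Re (cinner ((adj T \<circ> T) x - id x) x) = 0"
      using that by (simp add: cinner.diff_left adjT)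
    ultimately have "(adj T \<circ> T) x - id x = 0" by (rule positive_op_eq_0)
    then show ?thesis by simp
  qed
  \<comment> \<open>The inequality between \<open>abs_op T\<close> and
    \<open>abs_op (Re_op T)\<close> enters here, at vectors on which \<open>T\<close> preserves the
    norm.\<close>
  have lower: "norm x \<le> norm ((1/2) *\<^sub>R (T x + adj T x))" if "norm (T x) = norm x" for x
    using norm_le_of_abs_op_le[OF T bounded_op_Re[OF T] assms(8) fixed[OF that]]
    by (simp add: Re_op_def)

  have SS: "S (S y) = y" if "y \<in> G" for y
  proof -
    have Sy: "S y \<in> G" using block(2)[OF that zero] .
    have iso: "norm (T (S y)) = norm (S y)" using Sy by (simp add: TG nS)
    \<comment> \<open>\<open>S y\<close> is \<open>T y\<close>, and \<open>T\<close> preserves the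
      norm of \<open>y\<close>.\<close>
    have "adj T (S y) = y" using fixed[of y] that by (simp add: TG nS)
    then have "norm y \<le> norm ((1/2) *\<^sub>R (S (S y) + y))"
      using lower[OF iso] Sy that by (simp add: TG nS)
    then show ?thesis
      by (intro eq_of_norm_le_norm_mean[of _ "norm y"]) (simp_all add: nS Sy that)
  qed
  have R0: "R y = 0" if "y \<in> ortho_compl G" for y
  proof -
    have "R y \<in> G" using block(3)[OF sub(1) that] .
    \<comment> \<open>As \<open>S\<close> is an involution on \<open>G\<close>, the vector
      \<open>R y\<close> is itself in the range of \<open>S\<close>, to which it is
      orthogonal.\<close>
    then have "cinner (R y) (R y) = 0"
      using SR[of "S (R y)" y] SS block(2)[OF _ zero] that by simp
    then show ?thesis by simp
  qed
  have iso: "norm (T x) = norm x" for x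
  proof -
    obtain g h where gh: "g \<in> G" "h \<in> ortho_compl G" "x = g + h"
      using ortho_decomposition[OF G] by blast
    \<comment> \<open>Now \<open>T h = Q h\<close>, and the lower bound for \<open>T\<close> meets
      the upper bound for \<open>Q\<close>. Pythagoras then handles the sum.\<close>
    have "norm (Q h) = norm h"
      using ge[of h] nQ[OF gh(2)] TH[OF gh(2)] R0[OF gh(2)] by simp
    moreover have "T x = S g + Q h" using block(1)[OF gh(1,2)] R0[OF gh(2)] gh(3) by simp
    ultimately have "(norm (T x))\<^sup>2 = (norm x)\<^sup>2"
      using gh block(2,4)[OF gh(1,2)] by (simp add: norm_add_sq orth nS)
    then show ?thesis by simp
  qed
  have "norm (adj T x) \<le> norm x" for x
  proof -
    \<comment> \<open>The adjoint of an isometry is a contraction: \<open>T (adj T x)\<close> has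
      the norm of \<open>adj T x\<close>.\<close>
    have "norm (adj T x) * norm (adj T x) = Re (cinner (T (adj T x)) x)"
      by (simp only: adjT(2)[symmetric] Re_cinner_self power2_eq_square)
    also have "\<dots> \<le> norm (adj T x) * norm x"
      using Re_cinner_le[of "T (adj T x)" x] by (simp add: iso)
    finally show ?thesis by (cases "adj T x = 0") auto
  qed
  then have "T x = adj T x" for x
    using lower[OF iso, of x] by (intro eq_of_norm_le_norm_mean[of _ "norm x"]) (simp_all add: iso)
  then have "adj T = T" by (simp add: fun_eq_iff)
  \<comment> \<open>With \<open>adj T = T\<close>, the relation \<open>adj T (T x) = x\<close> gives
    both identities required of a unitary operator.\<close>
  then show ?thesis
    using T fixed[OF iso]
    by (simp add: selfadjoint_op_def symmetry_op_def unitary_op_def fun_eq_iff)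
qed

end
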